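(* Let $(X,\sigma)$ be a minimal subshift over a finite alphabet, with recurrence function $R_X$ and topological full group $[[\sigma]]$. Let $\Gamma$ be a finitely generated subgroup of $[[\sigma]]$. Then $$\mathcal{L}_{\Gamma}(n) \preceq \big(2R_X(n)\big)!.$$ In particular this holds for $\Gamma = [[\sigma]]'$, the derived subgroup of $[[\sigma]]$.
   Context: $\mathbb{N}=\{1,2,3,\dots\}$. Subshifts. Let $A$ be a finite discrete set with $|A|\geq 2$, give $A^{\mathbb{Z}}$ the product topology, and let $\sigma$ be the shift homeomorphism $\sigma(\mathbf{a})_i=a_{i+1}$. An $n$-factor of a (finite or bi-infinite) word $w$ is a word $w_kw_{k+1}\cdots w_{k+n-1}\in A^n$ of consecutive letters of $w$; $F_n(w)$ is the set of $n$-factors of $w$. A word $\mathbf{x}\in A^{\mathbb{Z}}$ is uniformly recurrent if for every $n\in\mathbb{N}$ there is $M_n\in\mathbb{N}$ such that $w\in F_n(v)$ for every $w\in F_n(\mathbf{x})$ and every $v\in F_{M_n}(\mathbf{x})$; the smallest such $M_n$ is denoted $R_{\mathbf{x}}(n)$ and $R_{\mathbf{x}}$ is the recurrence function. It is non-periodic if $\sigma^p\mathbf{x}\neq\mathbf{x}$ for all $p\geq 1$. A minimal subshift is $X=\overline{\{\sigma^i\mathbf{x}:i\in\mathbb{Z}\}}\subseteq A^{\mathbb{Z}}$ with $\mathbf{x}$ uniformly recurrent and non-periodic; $F_n(\mathbf{y})=F_n(\mathbf{x})$ for all $\mathbf{y}\in X$, so $R_X:=R_{\mathbf{x}}$ depends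 only on $X$. Topological full group. $[[\sigma]]$ is the group of homeomorphisms $g$ of $X$ for which there is a continuous $f_g:X\to\mathbb{Z}$ (with $\mathbb{Z}$ discrete) such that $g(x)=\sigma^{f_g(x)}(x)$ for all $x\in X$. The derived subgroup $[[\sigma]]'$ of a minimal subshift is known to be finitely generated. LEF growth. For groups $\Gamma,\Delta$ and $F\subseteq\Gamma$, a local embedding of $F$ into $\Delta$ is an injective map $\phi:F\to\Delta$ such that $\phi(gh)=\phi(g)\phi(h)$ whenever $g,h,gh\in F$. $\Gamma$ is LEF if every finite subset of $\Gamma$ has a local embedding into some finite group; it is known that $[[\sigma]]$ is LEF. If $S$ is a finite generating set of the LEF group $\Gamma$ and $B_S(n)$ is the set of elements of word length at most $n$ with respect to $S$, then $\mathcal{L}_\Gamma^S(n)$ is the minimal order of a finite group $Q$ admitting a local embedding $B_S(n)\to Q$. $\mathcal{L}_\Gamma$ denotes $\mathcal{L}_\Gamma^S$ for any finite generating set $S$; the statement does not depend on $S$. Comparison. For nondecreasing functions $F_1,F_2$, write $F_1\preceq F_2$ if there is a constant $C>0$ (which may be taken to be a positive integer) such that $F_1(n)\leq F_2(Cn)$ for all $n\in\mathbb{N}$. *)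

theory Defs
  imports
    "HOL-Analysis.Analysis"
    "HOL-Library.Extended_Nat"
    "HOL-Algebra.Bij"
    "HOL-Algebra.Generated_Groups"
begin

section \<open>Subshifts\<close>

text \<open>
  The alphabet is a type of class \<open>{finite, discrete_topology}\<close>; the type \<open>int \<Rightarrow> 'a\<close> of
  bi-infinite words then carries the product topology (library instance for functions).
\<close>

definition shift :: "(int \<Rightarrow> 'a) \<Rightarrow> (int \<Rightarrow> 'a)" where
  "shift a = (\<lambda>i. a (i + 1))"

definition shift_pow :: "int \<Rightarrow> (int \<Rightarrow> 'a) \<Rightarrow> (int \<Rightarrow> 'a)" where
  "shift_pow k = (if 0 \<le> k then shift ^^ nat k else inv_into UNIV shift ^^ nat (- k))"

lemma shift_pow_apply: "shift_pow k a i = a (i + k)"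
proof -
  have inv: "inv_into UNIV shift = (\<lambda>(a :: int \<Rightarrow> 'a) i. a (i - 1))"
    by (rule inv_unique_comp) (auto simp: shift_def fun_eq_iff)
  have pos: "(shift ^^ n) b i = b (i + int n)" for n :: nat and b :: "int \<Rightarrow> 'a" and i
    by (induction n arbitrary: i) (auto simp: shift_def algebra_simps)
  have neg: "(inv_into UNIV shift ^^ n) b i = b (i - int n)" for n :: nat and b :: "int \<Rightarrow> 'a" and i
    by (induction n arbitrary: i) (auto simp: inv algebra_simps)
  show ?thesis
    by (auto simp: shift_pow_def pos neg)
qed

definition factors_biinf :: "nat \<Rightarrow> (int \<Rightarrow> 'a) \<Rightarrow> 'a list set" where
  "factors_biinf n x = {map (\<lambda>i. x (k + int i)) [0..<n] | k. True}"

definition factors_list :: "nat \<Rightarrow> 'a list \<Rightarrow> 'a list set" where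
  "factors_list n v = {take n (drop k v) | k. k + n \<le> length v}"

definition recurrence_bound :: "(int \<Rightarrow> 'a) \<Rightarrow> nat \<Rightarrow> nat \<Rightarrow> bool" where
  "recurrence_bound x n M \<longleftrightarrow>
     (\<forall>w \<in> factors_biinf n x. \<forall>v \<in> factors_biinf M x. w \<in> factors_list n v)"

definition uniformly_recurrent :: "(int \<Rightarrow> 'a) \<Rightarrow> bool" where
  "uniformly_recurrent x \<longleftrightarrow> (\<forall>n\<ge>1. \<exists>M\<ge>1. recurrence_bound x n M)"

definition recurrence_function :: "(int \<Rightarrow> 'a) \<Rightarrow> nat \<Rightarrow> nat" where
  "recurrence_function x n = (LEAST M. M \<ge> 1 \<and> recurrence_bound x n M)"

definition non_periodic :: "(int \<Rightarrow> 'a) \<Rightarrow> bool" where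
  "non_periodic x \<longleftrightarrow> (\<forall>p\<ge>1. (shift ^^ p) x \<noteq> x)"

definition orbit_closure :: "(int \<Rightarrow> 'a :: discrete_topology) \<Rightarrow> (int \<Rightarrow> 'a) set" where
  "orbit_closure x = closure {shift_pow i x | i. True}"


section \<open>The topological full group\<close>

text \<open>
  Self-maps of \<open>X\<close> are represented by functions that are \<open>extensional\<close> on \<open>X\<close>, as in \<open>BijGroup\<close>.
\<close>

definition topological_full_group ::
    "(int \<Rightarrow> 'a :: discrete_topology) set \<Rightarrow> ((int \<Rightarrow> 'a) \<Rightarrow> (int \<Rightarrow> 'a)) monoid" where
  "topological_full_group X = BijGroup X
     \<lparr>carrier := {g \<in> extensional X.
        (\<exists>h. homeomorphism X X g h) \<and>
        (\<exists>f :: (int \<Rightarrow> 'a) \<Rightarrow> int. continuous_on X f \<and> (\<forall>y\<in>X. g y = shift_pow (f y) y))}\<rparr>"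


section \<open>LEF growth\<close>

definition local_embedding ::
    "('g, 'm) monoid_scheme \<Rightarrow> 'g set \<Rightarrow> ('h, 'n) monoid_scheme \<Rightarrow> ('g \<Rightarrow> 'h) \<Rightarrow> bool" where
  "local_embedding G F H \<phi> \<longleftrightarrow>
     \<phi> ` F \<subseteq> carrier H \<and> inj_on \<phi> F \<and>
     (\<forall>g\<in>F. \<forall>h\<in>F. g \<otimes>\<^bsub>G\<^esub> h \<in> F \<longrightarrow> \<phi> (g \<otimes>\<^bsub>G\<^esub> h) = \<phi> g \<otimes>\<^bsub>H\<^esub> \<phi> h)"

definition word_ball :: "('g, 'm) monoid_scheme \<Rightarrow> 'g set \<Rightarrow> nat \<Rightarrow> 'g set" where
  "word_ball G S n =
     {foldr (\<lambda>a b. a \<otimes>\<^bsub>G\<^esub> b) ws \<one>\<^bsub>G\<^esub> | ws. set ws \<subseteq> S \<union> m_inv G ` S \<and> length ws \<le> n}"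

text \<open>
  Every finite group is isomorphic to one with carrier in \<open>nat\<close>, so it suffices to let \<open>Q\<close> range
  over \<open>nat monoid\<close>. The infimum is taken in \<open>enat\<close> so that the value is \<open>\<infinity>\<close> (rather than
  a junk value) when the ball has no local embedding into any finite group.
\<close>

definition LEF_growth :: "('g, 'm) monoid_scheme \<Rightarrow> 'g set \<Rightarrow> nat \<Rightarrow> enat" where
  "LEF_growth G S n =
     Inf {enat (order Q) | Q :: nat monoid.
            group Q \<and> finite (carrier Q) \<and> (\<exists>\<phi>. local_embedding G (word_ball G S n) Q \<phi>)}"

definition finite_generating_set :: "('g, 'm) monoid_scheme \<Rightarrow> 'g set \<Rightarrow> 'g set \<Rightarrow> bool" where
  "finite_generating_set G H S \<longleftrightarrow> finite S \<and> S \<subseteq> H \<and> generate G S = H"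


section \<open>Comparison of growth functions\<close>

definition growth_le :: "(nat \<Rightarrow> 'b :: order) \<Rightarrow> (nat \<Rightarrow> 'b) \<Rightarrow> bool" (infix \<open>\<preceq>\<^sub>g\<close> 50) where
  "F1 \<preceq>\<^sub>g F2 \<longleftrightarrow> (\<exists>C::nat. C > 0 \<and> (\<forall>n\<ge>1. F1 n \<le> F2 (C * n)))"

end

theory Submission
  imports Defs "HOL-Algebra.Sym_Groups" "HOL-Algebra.Weak_Morphisms"
begin

text \<open>
  The orbit of a non-periodic point \<open>x\<close> is a copy of \<open>\<int>\<close>, so the full group acts on \<open>\<int>\<close>, faithfully
  because the orbit is dense. An element of word length \<open>n\<close> moves each integer by at most \<open>r n\<close>,
  and by an amount that depends only on the letters of \<open>x\<close> at distance at most \<open>r n\<close>. Let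
  \<open>N = (4 r + 1) n\<close> and \<open>R = R\<^sub>X(N)\<close>. The first \<open>N\<close>-factor of \<open>x\<close> occurs again with a shift
  \<open>m \<in> [R, 2 R]\<close>, hence every \<open>N\<close>-factor of the cyclic word \<open>x\<^sub>1 \<dots> x\<^sub>m\<close> is a factor of \<open>x\<close>, and the
  ball of radius \<open>n\<close> acts on the \<open>m\<close> positions of this word. Since \<open>m \<ge> R\<close>, every \<open>N\<close>-factor of
  \<open>x\<close> occurs in the cyclic word, so distinct elements of the ball act differently. This is a
  local embedding into the symmetric group on \<open>m \<le> 2 R\<close> points.
\<close>

section \<open>Symbolic dynamics\<close>

lemma shift_pow_0 [simp]: "shift_pow 0 y = y"
  by (simp add: fun_eq_iff shift_pow_apply)

lemma shift_pow_shift_pow [simp]: "shift_pow a (shift_pow b y) = shift_pow (a + b) y"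
  by (simp add: fun_eq_iff shift_pow_apply algebra_simps)

lemma funpow_shift: "(shift ^^ n) y = shift_pow (int n) y"
  by (simp add: shift_pow_def)

lemma non_periodic_shift_pow_eq_iff:
  assumes "non_periodic x"
  shows "shift_pow a x = shift_pow b x \<longleftrightarrow> a = b"
proof -
  have False if less: "a < b" and eq: "shift_pow a x = shift_pow b x" for a b
  proof -
    have "shift_pow (- a) (shift_pow a x) = shift_pow (- a) (shift_pow b x)"
      using eq by simp
    then have "(shift ^^ nat (b - a)) x = x"
      using less by (simp add: funpow_shift)
    moreover have "nat (b - a) \<ge> 1"
      using less by simp
    ultimately show False
      using assms by (auto simp: non_periodic_def)
  qed
  then show ?thesis
    by (metis linorder_neqE)
qed

section \<open>Compactness, cylinder sets and locally constant functions\<close>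

lemma compact_orbit_closure:
  fixes x :: "int \<Rightarrow> 'a :: {finite, discrete_topology}"
  shows "compact (orbit_closure x)"
proof -
  have "compact_space (euclidean :: 'a topology)"
    by (simp add: compact_space_def finite_imp_compact)
  then have "compact_space (product_topology (\<lambda>i::int. euclidean :: 'a topology) UNIV)"
    by (simp add: compact_space_product_topology)
  then have "compact (UNIV :: (int \<Rightarrow> 'a) set)"
    by (simp add: euclidean_product_topology compact_space_def)
  then have "compact (UNIV \<inter> orbit_closure x)"
    by (rule compact_Int_closed) (simp add: orbit_closure_def)
  then show ?thesis
    by simp
qed

lemma shift_pow_in_orbit_closure: "shift_pow a x \<in> orbit_closure x"
  unfolding orbit_closure_def by (rule subsetD[OF closure_subset]) blast

lemma open_cylinder:
  fixes y :: "int \<Rightarrow> 'a :: discrete_topology"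
  shows "open {z. \<forall>i. \<bar>i\<bar> \<le> r \<longrightarrow> z i = y i}"
proof -
  have "open ((\<lambda>z :: int \<Rightarrow> 'a. z i) -` {y i})" for i
    by (rule open_vimage) (auto simp: open_discrete)
  then have "open (\<Inter>i\<in>{-r..r}. (\<lambda>z :: int \<Rightarrow> 'a. z i) -` {y i})"
    by (intro open_INT) auto
  also have "(\<Inter>i\<in>{-r..r}. (\<lambda>z :: int \<Rightarrow> 'a. z i) -` {y i}) = {z. \<forall>i. \<bar>i\<bar> \<le> r \<longrightarrow> z i = y i}"
    by (auto simp: abs_le_iff)
  finally show ?thesis .
qed

text \<open>A basic open box of the product topology constrains only finitely many coordinates;
  \<open>r\<close> is the largest absolute value among them.\<close>

lemma open_contains_cylinder:
  fixes U :: "(int \<Rightarrow> 'a :: topological_space) set"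
  assumes "open U" "y \<in> U"
  obtains r where "0 \<le> r" "\<And>z. (\<And>i. \<bar>i\<bar> \<le> r \<Longrightarrow> z i = y i) \<Longrightarrow> z \<in> U"
proof -
  have "openin (product_topology (\<lambda>i. euclidean) UNIV) U"
    using assms(1) by (simp add: euclidean_product_topology)
  from product_topology_open_contains_basis[OF this assms(2)]
  obtain V where V: "y \<in> (\<Pi>\<^sub>E i\<in>UNIV. V i)" "finite {i. V i \<noteq> UNIV}" "(\<Pi>\<^sub>E i\<in>UNIV. V i) \<subseteq> U"
    by auto
  define r where "r = Max (insert 0 (abs ` {i. V i \<noteq> UNIV}))"
  have r: "\<bar>i\<bar> \<le> r" if "V i \<noteq> UNIV" for i
    unfolding r_def using V(2) that by (intro Max_ge) auto
  have "0 \<le> r"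
    unfolding r_def using V(2) by (intro Max_ge) auto
  moreover have "z \<in> U" if z: "\<And>i. \<bar>i\<bar> \<le> r \<Longrightarrow> z i = y i" for z
  proof -
    have "z i \<in> V i" for i
    proof (cases "V i = UNIV")
      case False
      then show ?thesis
        using z[OF r] V(1) by (auto simp: PiE_iff)
    qed simp
    then show ?thesis
      using V(3) by (auto simp: PiE_iff)
  qed
  ultimately show ?thesis
    by (rule that)
qed

lemma orbit_closure_approx:
  assumes "y \<in> orbit_closure x"
  obtains a where "\<And>i. \<bar>i\<bar> \<le> r \<Longrightarrow> x (a + i) = y i"
proof -
  let ?C = "{z. \<forall>i. \<bar>i\<bar> \<le> r \<longrightarrow> z i = y i}"
  have "?C \<inter> closure {shift_pow i x | i. True} \<noteq> {}"
    using assms by (auto simp: orbit_closure_def)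
  then have "?C \<inter> {shift_pow i x | i. True} \<noteq> {}"
    using open_Int_closure_eq_empty[OF open_cylinder] by blast
  then show ?thesis
    using that by (fastforce simp: shift_pow_apply add.commute)
qed

text \<open>Both functions are locally constant, so near each point every combination of them is
  constant, whatever \<open>\<phi>\<close> is. It provides the sums and negatives of
  cocycles.\<close>

lemma continuous_on_discrete_combine:
  fixes f :: "'a :: topological_space \<Rightarrow> 'b :: discrete_topology"
    and g :: "'a \<Rightarrow> 'c :: discrete_topology" and \<phi> :: "'b \<Rightarrow> 'c \<Rightarrow> 'd :: topological_space"
  assumes "continuous_on S f" "continuous_on S g"
  shows "continuous_on S (\<lambda>y. \<phi> (f y) (g y))"
  unfolding continuous_on_topological
proof (intro ballI allI impI)
  fix y and B :: "'d set"
  assume y: "y \<in> S" and B: "\<phi> (f y) (g y) \<in> B"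
  obtain U where U: "open U" "y \<in> U" "\<forall>z\<in>S. z \<in> U \<longrightarrow> f z \<in> {f y}"
    using assms(1) y open_discrete unfolding continuous_on_topological by (meson singletonI)
  obtain V where V: "open V" "y \<in> V" "\<forall>z\<in>S. z \<in> V \<longrightarrow> g z \<in> {g y}"
    using assms(2) y open_discrete unfolding continuous_on_topological by (meson singletonI)
  show "\<exists>A. open A \<and> y \<in> A \<and> (\<forall>z\<in>S. z \<in> A \<longrightarrow> \<phi> (f z) (g z) \<in> B)"
    using U V B by (intro exI[of _ "U \<inter> V"]) auto
qed

text \<open>Each point has a cylinder on which \<open>f\<close> is constant, and finitely many of
  them cover \<open>X\<close>. The largest radius and the largest absolute value over this subcover
  give one \<open>r\<close> that serves both as window radius and as bound.\<close>

lemma continuous_on_compact_word_function: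
  fixes f :: "(int \<Rightarrow> 'a :: discrete_topology) \<Rightarrow> int"
  assumes "compact X" "continuous_on X f"
  obtains r where "0 \<le> r" "\<And>y. y \<in> X \<Longrightarrow> \<bar>f y\<bar> \<le> r"
    "\<And>y z. y \<in> X \<Longrightarrow> z \<in> X \<Longrightarrow> (\<And>i. \<bar>i\<bar> \<le> r \<Longrightarrow> y i = z i) \<Longrightarrow> f y = f z"
proof -
  have "\<exists>r\<ge>0. \<forall>z\<in>X. (\<forall>i. \<bar>i\<bar> \<le> r \<longrightarrow> z i = y i) \<longrightarrow> f z = f y" if y: "y \<in> X" for y
  proof -
    have "open {f y}"
      by (rule open_discrete)
    then obtain A where A: "open A" "A \<inter> X = f -` {f y} \<inter> X"
      using assms(2) unfolding continuous_on_open_invariant by blast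
    then have "y \<in> A"
      using y by auto
    with A(1) obtain r where "0 \<le> r" "\<And>z. (\<And>i. \<bar>i\<bar> \<le> r \<Longrightarrow> z i = y i) \<Longrightarrow> z \<in> A"
      using open_contains_cylinder by metis
    then show ?thesis
      using A(2) by blast
  qed
  then obtain \<rho> where \<rho>: "\<And>y. y \<in> X \<Longrightarrow> 0 \<le> \<rho> y"
    "\<And>y z. y \<in> X \<Longrightarrow> z \<in> X \<Longrightarrow> (\<And>i. \<bar>i\<bar> \<le> \<rho> y \<Longrightarrow> z i = y i) \<Longrightarrow> f z = f y"
    by metis
  define cyl where "cyl y = {z. \<forall>i. \<bar>i\<bar> \<le> \<rho> y \<longrightarrow> z i = y i}" for y
  have open_cyl: "open (cyl y)" for y
    unfolding cyl_def by (rule open_cylinder)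
  have "X \<subseteq> (\<Union>y\<in>X. cyl y)"
    by (auto simp: cyl_def)
  then obtain Y where Y: "Y \<subseteq> X" "finite Y" "X \<subseteq> (\<Union>y\<in>Y. cyl y)"
    by (rule compactE_image[OF assms(1) open_cyl])
  define r where "r = Max (insert 0 (\<rho> ` Y \<union> (\<lambda>y. \<bar>f y\<bar>) ` Y))"
  have r0: "0 \<le> r"
    unfolding r_def using Y(2) by (intro Max_ge) auto
  have r: "\<rho> y \<le> r" "\<bar>f y\<bar> \<le> r" if "y \<in> Y" for y
    unfolding r_def using Y(2) that by (intro Max_ge; simp)+
  have cyl: "f z = f y" if "y \<in> Y" "z \<in> X" "z \<in> cyl y" for y z
    using that Y(1) by (intro \<rho>(2)) (auto simp: cyl_def)
  show ?thesis
  proof (rule that[OF r0])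
    show "\<bar>f z\<bar> \<le> r" if "z \<in> X" for z
      using Y(3) that cyl r(2) by fastforce
    show "f y = f z" if yz: "y \<in> X" "z \<in> X" "\<And>i. \<bar>i\<bar> \<le> r \<Longrightarrow> y i = z i" for y z
    proof -
      obtain u where u: "u \<in> Y" "y \<in> cyl u"
        using Y(3) yz(1) by auto
      then have "z \<in> cyl u"
        using yz(3) r(1)[OF u(1)] by (auto simp: cyl_def)
      then show ?thesis
        using cyl u yz by metis
    qed
  qed
qed

text \<open>Recurrence in coordinates: the factor at \<open>a\<close> is searched for in the block
  of length \<open>R\<close> that starts at \<open>b\<close>, and \<open>k\<close> is its offset
  there.\<close>

lemma recurrence_functionD:
  fixes x :: "int \<Rightarrow> 'a"
  assumes "uniformly_recurrent x" "N \<ge> 1"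
  defines "R \<equiv> int (recurrence_function x N)"
  obtains k where "0 \<le> k" "k + int N \<le> R" "\<And>i. 0 \<le> i \<Longrightarrow> i < int N \<Longrightarrow> x (b + k + i) = x (a + i)"
proof -
  let ?R = "recurrence_function x N"
  have "?R \<ge> 1 \<and> recurrence_bound x N ?R"
    using assms(1,2) unfolding recurrence_function_def uniformly_recurrent_def
    by (metis (mono_tags, lifting) LeastI)
  then have "map (\<lambda>i. x (a + int i)) [0..<N] \<in> factors_list N (map (\<lambda>i. x (b + int i)) [0..<?R])"
    unfolding recurrence_bound_def factors_biinf_def by blast
  then obtain k where k: "k + N \<le> ?R"
    and eq: "map (\<lambda>i. x (a + int i)) [0..<N] = take N (drop k (map (\<lambda>i. x (b + int i)) [0..<?R]))"
    by (auto simp: factors_list_def)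
  have "x (b + int k + i) = x (a + i)" if "0 \<le> i" "i < int N" for i
    using arg_cong[OF eq, of "\<lambda>l. l ! nat i"] that k by (simp add: algebra_simps)
  then show ?thesis
    using that[of "int k"] k by (simp add: R_def)
qed

section \<open>The topological full group as permutations of an orbit\<close>

lemma homeomorphism_bij_betw: "homeomorphism S T f g \<Longrightarrow> bij_betw f S T"
  by (rule bij_betw_byWitness[of _ g]) (auto simp: homeomorphism_def)

lemma topological_full_group_mult:
  assumes "g \<in> carrier (topological_full_group X)" "h \<in> carrier (topological_full_group X)"
  shows "g \<otimes>\<^bsub>topological_full_group X\<^esub> h = compose X g h"
proof -
  have "f \<in> Bij X" if "f \<in> carrier (topological_full_group X)" for f
    using that by (auto simp: topological_full_group_def Bij_def dest: homeomorphism_bij_betw)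
  then show ?thesis
    using assms by (simp add: topological_full_group_def BijGroup_def)
qed

lemma topological_full_group_one: "\<one>\<^bsub>topological_full_group X\<^esub> = (\<lambda>y\<in>X. y)"
  by (simp add: topological_full_group_def BijGroup_def)

lemma topological_full_groupE:
  assumes "g \<in> carrier (topological_full_group X)"
  obtains h f where "homeomorphism X X g h" "continuous_on X f" "\<And>y. y \<in> X \<Longrightarrow> g y = shift_pow (f y) y"
  using assms by (auto simp: topological_full_group_def)

text \<open>It is a subgroup of \<open>BijGroup X\<close>: the identity has cocycle 0, the inverse
  \<open>h\<close> of \<open>g\<close> has cocycle \<open>- f (h y)\<close>, and a product has
  cocycle \<open>f (g' y) + f' y\<close>.\<close>

lemma group_topological_full_group:
  fixes X :: "(int \<Rightarrow> 'a :: discrete_topology) set"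
  shows "group (topological_full_group X)"
proof -
  let ?T = "carrier (topological_full_group X)"
  have T: "g \<in> ?T \<longleftrightarrow> g \<in> extensional X \<and> (\<exists>h. homeomorphism X X g h) \<and>
      (\<exists>f :: (int \<Rightarrow> 'a) \<Rightarrow> int. continuous_on X f \<and> (\<forall>y\<in>X. g y = shift_pow (f y) y))" for g
    by (simp add: topological_full_group_def)
  have sub: "?T \<subseteq> Bij X"
    by (auto simp: T Bij_def dest: homeomorphism_bij_betw)
  have "subgroup ?T (BijGroup X)"
  proof (rule group.subgroupI[OF group_BijGroup])
    show "?T \<subseteq> carrier (BijGroup X)"
      using sub by (simp add: BijGroup_def)
    have "(\<lambda>y\<in>X. y) \<in> ?T"
      unfolding T
      by (auto intro!: exI[of _ "\<lambda>_. 0"] exI[of _ "\<lambda>y. y"] simp: homeomorphism_def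
          cong: continuous_on_cong)
    then show "?T \<noteq> {}"
      by blast
  next
    fix g
    assume "g \<in> ?T"
    then obtain h and f :: "(int \<Rightarrow> 'a) \<Rightarrow> int"
      where gh: "homeomorphism X X g h" and f: "continuous_on X f"
        and g: "\<And>y. y \<in> X \<Longrightarrow> g y = shift_pow (f y) y"
      by (rule topological_full_groupE) (rule that; blast)
    have bij: "g \<in> Bij X"
      using \<open>g \<in> ?T\<close> sub by blast
    have hX: "h y \<in> X" "g (h y) = y" if "y \<in> X" for y
      using gh that by (auto simp: homeomorphism_def)
    have inv: "inv\<^bsub>BijGroup X\<^esub> g = (\<lambda>y\<in>X. h y)"
      unfolding inv_BijGroup[OF bij]
    proof (rule restrict_ext)
      fix y assume "y \<in> X"
      then show "inv_into X g y = h y"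
        using bij hX by (metis Bij_def Int_iff bij_betw_imp_inj_on inv_into_f_eq mem_Collect_eq)
    qed
    have fh: "continuous_on X (\<lambda>y. f (h y))"
      using gh by (intro continuous_on_compose2[OF f]) (auto simp: homeomorphism_def)
    have "homeomorphism X X (\<lambda>y\<in>X. h y) g"
      by (rule homeomorphism_cong[OF homeomorphism_symD[OF gh]]) auto
    moreover have "continuous_on X (\<lambda>y. - f (h y))"
      by (rule continuous_on_discrete_combine[OF fh fh, of "\<lambda>a b. - a"])
    moreover have "h y = shift_pow (- f (h y)) y" if "y \<in> X" for y
    proof -
      have "shift_pow (- f (h y)) (g (h y)) = h y"
        using g hX(1)[OF that] by simp
      then show ?thesis
        using hX(2)[OF that] by simp
    qed
    ultimately show "inv\<^bsub>BijGroup X\<^esub> g \<in> ?T"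
      unfolding inv T by auto
  next
    fix g g'
    assume gg: "g \<in> ?T" "g' \<in> ?T"
    obtain h and f :: "(int \<Rightarrow> 'a) \<Rightarrow> int"
      where gh: "homeomorphism X X g h" and f: "continuous_on X f"
        and g: "\<And>y. y \<in> X \<Longrightarrow> g y = shift_pow (f y) y"
      using gg(1) by (rule topological_full_groupE) (rule that; blast)
    obtain h' and f' :: "(int \<Rightarrow> 'a) \<Rightarrow> int"
      where gh': "homeomorphism X X g' h'" and f': "continuous_on X f'"
        and g': "\<And>y. y \<in> X \<Longrightarrow> g' y = shift_pow (f' y) y"
      using gg(2) by (rule topological_full_groupE) (rule that; blast)
    have g'X: "g' y \<in> X" if "y \<in> X" for y
      using gh' that by (auto simp: homeomorphism_def)
    have mult: "g \<otimes>\<^bsub>BijGroup X\<^esub> g' = compose X g g'"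
      using gg sub by (auto simp: BijGroup_def)
    have fg': "continuous_on X (\<lambda>y. f (g' y))"
      using gh' by (intro continuous_on_compose2[OF f]) (auto simp: homeomorphism_def)
    have "homeomorphism X X (compose X g g') (h' \<circ> h)"
      by (rule homeomorphism_cong[OF homeomorphism_compose[OF gh' gh]]) (auto simp: compose_def)
    moreover have "continuous_on X (\<lambda>y. f (g' y) + f' y)"
      by (rule continuous_on_discrete_combine[OF fg' f'])
    moreover have "compose X g g' y = shift_pow (f (g' y) + f' y) y" if "y \<in> X" for y
    proof -
      have "compose X g g' y = shift_pow (f (g' y)) (g' y)"
        using g[OF g'X[OF that]] that by (simp add: compose_def)
      also have "\<dots> = shift_pow (f (g' y)) (shift_pow (f' y) y)"
        using g'[OF that] by simp
      finally show ?thesis by simp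
    qed
    ultimately show "g \<otimes>\<^bsub>BijGroup X\<^esub> g' \<in> ?T"
      unfolding mult T by auto
  qed
  then show ?thesis
    using group.subgroup_imp_group[OF group_BijGroup] by (auto simp: topological_full_group_def)
qed

text \<open>A sliding block rule: the displacement is read off a window of \<open>x\<close>. A
  single \<open>L\<close> bounds both displacement and window radius, so that only one parameter has
  to be tracked through products.\<close>

definition local_displacement :: "(int \<Rightarrow> 'a) \<Rightarrow> int \<Rightarrow> (int \<Rightarrow> int) \<Rightarrow> bool" where
  "local_displacement x L \<pi> \<longleftrightarrow>
     (\<forall>a. \<bar>\<pi> a - a\<bar> \<le> L) \<and>
     (\<forall>a b. (\<forall>t. \<bar>t\<bar> \<le> L \<longrightarrow> x (a + t) = x (b + t)) \<longrightarrow> \<pi> a - a = \<pi> b - b)"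

lemma local_displacement_bound: "local_displacement x L \<pi> \<Longrightarrow> \<bar>\<pi> a - a\<bar> \<le> L"
  by (simp add: local_displacement_def)

lemma local_displacement_cong:
  "local_displacement x L \<pi> \<Longrightarrow> (\<And>t. \<bar>t\<bar> \<le> L \<Longrightarrow> x (a + t) = x (b + t)) \<Longrightarrow> \<pi> a - a = \<pi> b - b"
  by (simp add: local_displacement_def)

lemma local_displacement_id: "0 \<le> L \<Longrightarrow> local_displacement x L (\<lambda>a. a)"
  by (simp add: local_displacement_def)

lemma local_displacement_mono:
  "local_displacement x L \<pi> \<Longrightarrow> L \<le> K \<Longrightarrow> local_displacement x K \<pi>"
  unfolding local_displacement_def by (meson order_trans)

text \<open>The map \<open>\<rho>\<close> moves \<open>a\<close> by at most \<open>K\<close>, so the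
  window of radius \<open>L\<close> that \<open>\<pi>\<close> reads at \<open>\<rho> a\<close> lies
  within distance \<open>L + K\<close> of \<open>a\<close>.\<close>

lemma local_displacement_compose:
  assumes "local_displacement x L \<pi>" "local_displacement x K \<rho>" "0 \<le> L" "0 \<le> K"
  shows "local_displacement x (L + K) (\<lambda>a. \<pi> (\<rho> a))"
  unfolding local_displacement_def
proof (intro conjI allI impI)
  fix a
  show "\<bar>\<pi> (\<rho> a) - a\<bar> \<le> L + K"
    using local_displacement_bound[OF assms(1), of "\<rho> a"] local_displacement_bound[OF assms(2), of a]
    by linarith
next
  fix a b
  assume eq: "\<forall>t. \<bar>t\<bar> \<le> L + K \<longrightarrow> x (a + t) = x (b + t)"
  have \<rho>: "\<rho> a - a = \<rho> b - b"
    using eq assms(3) by (intro local_displacement_cong[OF assms(2)]) auto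
  have "x (\<rho> a + t) = x (\<rho> b + t)" if "\<bar>t\<bar> \<le> L" for t
  proof -
    have "\<bar>\<rho> a - a + t\<bar> \<le> L + K"
      using local_displacement_bound[OF assms(2), of a] that by linarith
    then have "x (a + (\<rho> a - a + t)) = x (b + (\<rho> a - a + t))"
      using eq by blast
    moreover have "b + (\<rho> a - a + t) = \<rho> b + t"
      using \<rho> by simp
    ultimately show ?thesis
      by simp
  qed
  then have "\<pi> (\<rho> a) - \<rho> a = \<pi> (\<rho> b) - \<rho> b"
    by (rule local_displacement_cong[OF assms(1)])
  then show "\<pi> (\<rho> a) - a = \<pi> (\<rho> b) - b"
    using \<rho> by simp
qed

text \<open>
  The description below is proper only if \<open>x\<close> is non-periodic and \<open>g\<close> preserves the orbit of \<open>x\<close>.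
\<close>

definition orbit_map :: "(int \<Rightarrow> 'a) \<Rightarrow> ((int \<Rightarrow> 'a) \<Rightarrow> (int \<Rightarrow> 'a)) \<Rightarrow> int \<Rightarrow> int" where
  "orbit_map x g a = (THE b. g (shift_pow a x) = shift_pow b x)"

section \<open>The action on the orbit of a non-periodic point\<close>

locale nonperiodic_subshift =
  fixes x :: "int \<Rightarrow> 'a :: {finite, discrete_topology}"
  assumes non_periodic: "non_periodic x"
begin

abbreviation "X \<equiv> orbit_closure x"

abbreviation "TFG \<equiv> topological_full_group X"

sublocale TFG: group TFG
  by (rule group_topological_full_group)

text \<open>Non-periodicity makes the orbit point determine its index, so the \<open>THE\<close> in
  \<open>orbit_map\<close> picks out \<open>b\<close>.\<close>

lemma orbit_map_eqI: "g (shift_pow a x) = shift_pow b x \<Longrightarrow> orbit_map x g a = b"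
  unfolding orbit_map_def by (simp add: non_periodic_shift_pow_eq_iff[OF non_periodic])

lemma orbit_map:
  assumes "g \<in> carrier TFG"
  shows "g (shift_pow a x) = shift_pow (orbit_map x g a) x"
proof -
  obtain f where "g (shift_pow a x) = shift_pow (f (shift_pow a x)) (shift_pow a x)"
    using topological_full_groupE[OF assms] shift_pow_in_orbit_closure by metis
  then show ?thesis
    by (simp add: orbit_map_eqI)
qed

lemma orbit_map_one: "orbit_map x \<one>\<^bsub>TFG\<^esub> = (\<lambda>a. a)"
  by (rule ext, rule orbit_map_eqI)
    (simp add: topological_full_group_one shift_pow_in_orbit_closure)

lemma orbit_map_mult:
  assumes "g \<in> carrier TFG" "h \<in> carrier TFG"
  shows "orbit_map x (g \<otimes>\<^bsub>TFG\<^esub> h) = (\<lambda>a. orbit_map x g (orbit_map x h a))"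
  by (rule ext, rule orbit_map_eqI)
    (simp add: topological_full_group_mult assms compose_def shift_pow_in_orbit_closure orbit_map)

text \<open>This links the two pictures: along the orbit any cocycle of \<open>g\<close> is the
  displacement of its integer map, so properties of continuous functions on \<open>X\<close> pass to
  maps of the integers.\<close>

lemma orbit_map_cocycle:
  assumes "g \<in> carrier TFG" "\<And>y. y \<in> X \<Longrightarrow> g y = shift_pow (f y) y"
  shows "f (shift_pow a x) = orbit_map x g a - a"
proof -
  have "orbit_map x g a = f (shift_pow a x) + a"
    by (rule orbit_map_eqI) (simp add: assms(2) shift_pow_in_orbit_closure)
  then show ?thesis
    by simp
qed

text \<open>Faithfulness by density: the cocycles of \<open>g\<close> and \<open>h\<close> agree
  along the orbit, and each depends on a bounded window. Every \<open>y\<close> in \<open>X\<close>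
  shares a window wide enough for both with some orbit point, so the cocycles agree at
  \<open>y\<close>.\<close>

lemma orbit_map_inject:
  assumes g: "g \<in> carrier TFG" and h: "h \<in> carrier TFG" and eq: "orbit_map x g = orbit_map x h"
  shows "g = h"
proof -
  obtain u f where "homeomorphism X X g u"
    and f: "continuous_on X f" "\<And>y. y \<in> X \<Longrightarrow> g y = shift_pow (f y) y"
    using g by (rule topological_full_groupE) (rule that; blast)
  obtain u' f' where "homeomorphism X X h u'"
    and f': "continuous_on X f'" "\<And>y. y \<in> X \<Longrightarrow> h y = shift_pow (f' y) y"
    using h by (rule topological_full_groupE) (rule that; blast)
  obtain r where r: "\<And>y z. y \<in> X \<Longrightarrow> z \<in> X \<Longrightarrow> (\<And>i. \<bar>i\<bar> \<le> r \<Longrightarrow> y i = z i) \<Longrightarrow> f y = f z"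
    using continuous_on_compact_word_function[OF compact_orbit_closure f(1)] by metis
  obtain r' where r': "\<And>y z. y \<in> X \<Longrightarrow> z \<in> X \<Longrightarrow> (\<And>i. \<bar>i\<bar> \<le> r' \<Longrightarrow> y i = z i) \<Longrightarrow> f' y = f' z"
    using continuous_on_compact_word_function[OF compact_orbit_closure f'(1)] by metis
  have "g y = h y" if y: "y \<in> X" for y
  proof -
    obtain a where a: "\<And>i. \<bar>i\<bar> \<le> max r r' \<Longrightarrow> x (a + i) = y i"
      using orbit_closure_approx[OF y] by metis
    have "f y = f (shift_pow a x)"
      using a by (intro r y shift_pow_in_orbit_closure) (simp add: shift_pow_apply add.commute)
    also have "\<dots> = f' (shift_pow a x)"
      using orbit_map_cocycle[of g f, OF g f(2)] orbit_map_cocycle[of h f', OF h f'(2)] eq by simp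
    also have "\<dots> = f' y"
      using a by (intro r' y shift_pow_in_orbit_closure) (simp add: shift_pow_apply add.commute)
    finally show ?thesis
      using f(2)[OF y] f'(2)[OF y] by simp
  qed
  moreover have "g \<in> extensional X" "h \<in> extensional X"
    using g h by (auto simp: topological_full_group_def)
  ultimately show ?thesis
    by (metis extensionalityI)
qed

lemma orbit_map_local:
  assumes g: "g \<in> carrier TFG"
  obtains L where "0 \<le> L" "local_displacement x L (orbit_map x g)"
proof -
  obtain u f where "homeomorphism X X g u"
    and f: "continuous_on X f" "\<And>y. y \<in> X \<Longrightarrow> g y = shift_pow (f y) y"
    using g by (rule topological_full_groupE) (rule that; blast)
  obtain r where r: "0 \<le> r" "\<And>y. y \<in> X \<Longrightarrow> \<bar>f y\<bar> \<le> r"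
    "\<And>y z. y \<in> X \<Longrightarrow> z \<in> X \<Longrightarrow> (\<And>i. \<bar>i\<bar> \<le> r \<Longrightarrow> y i = z i) \<Longrightarrow> f y = f z"
    using continuous_on_compact_word_function[OF compact_orbit_closure f(1)] by metis
  have "local_displacement x r (orbit_map x g)"
    unfolding local_displacement_def
  proof (intro conjI allI impI)
    show "\<bar>orbit_map x g a - a\<bar> \<le> r" for a
      using r(2)[OF shift_pow_in_orbit_closure[of a]]
      by (simp add: orbit_map_cocycle[of g f, OF g f(2)])
    show "orbit_map x g a - a = orbit_map x g b - b"
      if "\<forall>t. \<bar>t\<bar> \<le> r \<longrightarrow> x (a + t) = x (b + t)" for a b
      using r(3)[OF shift_pow_in_orbit_closure[of a] shift_pow_in_orbit_closure[of b]] that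
      by (simp add: orbit_map_cocycle[of g f, OF g f(2)] shift_pow_apply add.commute)
  qed
  with r(1) show ?thesis
    by (rule that)
qed

text \<open>The inverse is constrained as well, so that the set is closed under inverses and the
  cyclic action of \<open>g\<close> will have the action of its inverse as inverse.\<close>

definition local_elements :: "int \<Rightarrow> ((int \<Rightarrow> 'a) \<Rightarrow> (int \<Rightarrow> 'a)) set" where
  "local_elements L = {g \<in> carrier TFG. local_displacement x L (orbit_map x g) \<and>
     local_displacement x L (orbit_map x (inv\<^bsub>TFG\<^esub> g))}"

lemma local_elements_mono: "L \<le> K \<Longrightarrow> local_elements L \<subseteq> local_elements K"
  by (auto simp: local_elements_def intro: local_displacement_mono)

lemma local_elements_one: "0 \<le> L \<Longrightarrow> \<one>\<^bsub>TFG\<^esub> \<in> local_elements L"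
  by (simp add: local_elements_def orbit_map_one local_displacement_id)

lemma local_elements_inv: "g \<in> local_elements L \<Longrightarrow> inv\<^bsub>TFG\<^esub> g \<in> local_elements L"
  by (auto simp: local_elements_def)

lemma local_elements_mult:
  assumes "g \<in> local_elements L" "h \<in> local_elements K" "0 \<le> L" "0 \<le> K"
  shows "g \<otimes>\<^bsub>TFG\<^esub> h \<in> local_elements (L + K)"
proof -
  have "local_displacement x (L + K) (orbit_map x (g \<otimes>\<^bsub>TFG\<^esub> h))"
    using assms by (auto simp: local_elements_def orbit_map_mult intro: local_displacement_compose)
  moreover have "local_displacement x (K + L) (orbit_map x (inv\<^bsub>TFG\<^esub> (g \<otimes>\<^bsub>TFG\<^esub> h)))"
    using assms
    by (auto simp: local_elements_def TFG.inv_mult_group orbit_map_mult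
        intro: local_displacement_compose)
  ultimately show ?thesis
    using assms by (auto simp: local_elements_def add.commute)
qed

text \<open>Radii add under multiplication, so the largest radius \<open>r\<close> over the finitely
  many generators gives radius \<open>r * n\<close> for words of length at most
  \<open>n\<close>.\<close>

lemma word_ball_subset_local_elements:
  assumes \<Gamma>: "subgroup \<Gamma> TFG" and S: "finite S" "S \<subseteq> \<Gamma>"
  obtains r :: nat where "\<And>n. word_ball (TFG\<lparr>carrier := \<Gamma>\<rparr>) S n \<subseteq> local_elements (int (r * n))"
proof -
  have "\<exists>r::nat. s \<in> local_elements (int r)" if "s \<in> S" for s
  proof -
    have s: "s \<in> carrier TFG"
      using that S subgroup.subset[OF \<Gamma>] by blast
    obtain L where L: "0 \<le> L" "local_displacement x L (orbit_map x s)"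
      using orbit_map_local[OF s] by blast
    obtain K where K: "0 \<le> K" "local_displacement x K (orbit_map x (inv\<^bsub>TFG\<^esub> s))"
      using orbit_map_local[OF TFG.inv_closed[OF s]] by blast
    have "s \<in> local_elements (int (nat (max L K)))"
      using s L K by (auto simp: local_elements_def intro: local_displacement_mono)
    then show ?thesis ..
  qed
  then obtain \<rho> :: "_ \<Rightarrow> nat" where \<rho>: "\<And>s. s \<in> S \<Longrightarrow> s \<in> local_elements (int (\<rho> s))"
    by metis
  define r where "r = Max (insert 0 (\<rho> ` S))"
  have "s \<in> local_elements (int r)" if "s \<in> S" for s
  proof -
    have "\<rho> s \<le> r"
      unfolding r_def using S(1) that by (intro Max_ge) auto
    then show ?thesis
      using \<rho>[OF that] local_elements_mono[of "int (\<rho> s)" "int r"] by auto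
  qed
  \<comment> \<open>Inverses in the subgroup coincide with inverses in the full group, and these
    keep the radius.\<close>
  then have gen: "s \<in> local_elements (int r)" if "s \<in> S \<union> m_inv (TFG\<lparr>carrier := \<Gamma>\<rparr>) ` S" for s
    using that local_elements_inv S(2) by (auto simp: TFG.m_inv_consistent[OF \<Gamma>] subset_iff)
  have words: "foldr (\<otimes>\<^bsub>TFG\<^esub>) ws \<one>\<^bsub>TFG\<^esub> \<in> local_elements (int (r * length ws))"
    if "set ws \<subseteq> S \<union> m_inv (TFG\<lparr>carrier := \<Gamma>\<rparr>) ` S" for ws
    using that
  proof (induction ws)
    case Nil
    then show ?case
      by (simp add: local_elements_one)
  next
    case (Cons s ws)
    then have "s \<otimes>\<^bsub>TFG\<^esub> foldr (\<otimes>\<^bsub>TFG\<^esub>) ws \<one>\<^bsub>TFG\<^esub> \<in> local_elements (int r + int (r * length ws))"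
      by (intro local_elements_mult gen) auto
    then show ?case
      by (simp add: algebra_simps)
  qed
  have "word_ball (TFG\<lparr>carrier := \<Gamma>\<rparr>) S n \<subseteq> local_elements (int (r * n))" for n
  proof
    fix g
    assume "g \<in> word_ball (TFG\<lparr>carrier := \<Gamma>\<rparr>) S n"
    then obtain ws where ws: "g = foldr (\<otimes>\<^bsub>TFG\<^esub>) ws \<one>\<^bsub>TFG\<^esub>" "length ws \<le> n"
      "set ws \<subseteq> S \<union> m_inv (TFG\<lparr>carrier := \<Gamma>\<rparr>) ` S"
      by (auto simp: word_ball_def)
    then show "g \<in> local_elements (int (r * n))"
      using words[OF ws(3)] local_elements_mono[of "int (r * length ws)" "int (r * n)"]
      by (auto simp del: of_nat_mult)
  qed
  then show ?thesis
    by (rule that)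
qed

end

section \<open>Periodic approximation\<close>

text \<open>Representatives run from 1 to \<open>m\<close>, to match the points permuted by
  \<open>sym_group (nat m)\<close>.\<close>

definition cyclic_residue :: "int \<Rightarrow> int \<Rightarrow> int" where
  "cyclic_residue m i = (i - 1) mod m + 1"

lemma cyclic_residue_range:
  assumes "0 < m"
  shows "1 \<le> cyclic_residue m i \<and> cyclic_residue m i \<le> m"
  using pos_mod_bound[OF assms, of "i - 1"] assms by (simp add: cyclic_residue_def add1_zle_eq)

lemma cyclic_residue_id: "1 \<le> i \<Longrightarrow> i \<le> m \<Longrightarrow> cyclic_residue m i = i"
  by (simp add: cyclic_residue_def)

lemma cyclic_residue_eq_iff: "cyclic_residue m i = cyclic_residue m j \<longleftrightarrow> m dvd i - j"
  by (simp add: cyclic_residue_def mod_eq_dvd_iff)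

lemma dvd_cyclic_residue_diff: "m dvd cyclic_residue m i - i"
proof -
  have "cyclic_residue m i - i = (i - 1) mod m - (i - 1)"
    by (simp add: cyclic_residue_def)
  then show ?thesis
    by (simp only: mod_eq_dvd_iff[symmetric] mod_mod_trivial)
qed

text \<open>
  If \<open>x\<close> agrees on \<open>[1, N]\<close> and \<open>[m + 1, m + N]\<close>, then a map of displacement at most \<open>L\<close> and
  locality radius \<open>L\<close> acts on the cyclic word \<open>x\<^sub>1 \<dots> x\<^sub>m\<close>. The offset \<open>2 * L\<close> centres the
  window of length \<open>4 * L + 1 \<le> N\<close> which starts at \<open>k\<close>: it has room for two successive maps.
\<close>

definition cyclic_action :: "int \<Rightarrow> int \<Rightarrow> (int \<Rightarrow> int) \<Rightarrow> nat \<Rightarrow> nat" where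
  "cyclic_action m L \<pi> k =
     (if k \<in> {1..nat m} then nat (cyclic_residue m (\<pi> (int k + 2 * L) - 2 * L)) else k)"

text \<open>The bound \<open>N \<le> m\<close> keeps the repeated block inside one period. It also
  gives \<open>2 * L < m\<close>, so that displacements can be recovered from their
  residues.\<close>

locale periodic_window =
  fixes x :: "int \<Rightarrow> 'a" and m N L :: int
  assumes L: "0 \<le> L" and N: "4 * L + 1 \<le> N" and m: "N \<le> m"
    and repeat: "\<And>i. 1 \<le> i \<Longrightarrow> i \<le> N \<Longrightarrow> x (m + i) = x i"
begin

lemma m_pos: "0 < m"
  using L N m by simp

text \<open>Past \<open>m\<close> the next \<open>N\<close> letters copy the first \<open>N\<close>,
  so on \<open>[1, m + N]\<close> the word \<open>x\<close> looks \<open>m\<close>-periodic.\<close>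

lemma word_eq_cyclic_residue:
  assumes "1 \<le> i" "i \<le> m + N"
  shows "x i = x (cyclic_residue m i)"
proof (cases "i \<le> m")
  case True
  then show ?thesis
    using assms by (simp add: cyclic_residue_id)
next
  case False
  have "cyclic_residue m i = cyclic_residue m (i - m)"
    by (simp add: cyclic_residue_eq_iff)
  also have "\<dots> = i - m"
    using False assms m by (intro cyclic_residue_id) auto
  finally show ?thesis
    using repeat[of "i - m"] False assms by simp
qed

lemma word_eq:
  assumes "1 \<le> i" "i \<le> m + N" "1 \<le> j" "j \<le> m + N" "m dvd i - j"
  shows "x i = x j"
  using assms by (metis cyclic_residue_eq_iff word_eq_cyclic_residue)

lemma cyclic_action_range: "k \<in> {1..nat m} \<Longrightarrow> cyclic_action m L \<pi> k \<in> {1..nat m}"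
  using cyclic_residue_range[OF m_pos, of "\<pi> (int k + 2 * L) - 2 * L"]
  by (auto simp: cyclic_action_def nat_le_eq_zle le_nat_iff)

lemma cyclic_action_id: "cyclic_action m L (\<lambda>a. a) = id"
  by (auto simp: cyclic_action_def fun_eq_iff cyclic_residue_id)

text \<open>After \<open>\<rho>\<close> the position may leave the cyclic word and be replaced by
  its residue. The two positions differ by a multiple of \<open>m\<close> and see the same window,
  so \<open>\<pi>\<close> moves them equally.\<close>

lemma cyclic_action_compose:
  assumes \<pi>: "local_displacement x L \<pi>" and \<rho>: "local_displacement x L \<rho>"
  shows "cyclic_action m L (\<lambda>a. \<pi> (\<rho> a)) = cyclic_action m L \<pi> \<circ> cyclic_action m L \<rho>"
proof
  fix k
  show "cyclic_action m L (\<lambda>a. \<pi> (\<rho> a)) k = (cyclic_action m L \<pi> \<circ> cyclic_action m L \<rho>) k"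
  proof (cases "k \<in> {1..nat m}")
    case False
    then show ?thesis
      by (simp add: cyclic_action_def del: atLeastAtMost_iff)
  next
    case True
    \<comment> \<open>\<open>a\<close> is where \<open>\<rho>\<close> sends the centre of the window
      at \<open>k\<close>; \<open>b\<close> is the centre of the window that starts at the residue
      of the new position.\<close>
    define a where "a = \<rho> (int k + 2 * L)"
    define b where "b = cyclic_residue m (a - 2 * L) + 2 * L"
    have k: "1 \<le> int k" "int k \<le> m"
      using True by auto
    have b: "1 + 2 * L \<le> b" "b \<le> m + 2 * L"
      using cyclic_residue_range[OF m_pos, of "a - 2 * L"] by (auto simp: b_def)
    have a: "int k + L \<le> a" "a \<le> int k + 3 * L"
      using local_displacement_bound[OF \<rho>, of "int k + 2 * L"] by (auto simp: a_def)
    have dvd: "m dvd b - a"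
      using dvd_cyclic_residue_diff[of m "a - 2 * L"] by (simp add: b_def algebra_simps)
    have "\<pi> b - b = \<pi> a - a"
    proof (rule local_displacement_cong[OF \<pi>])
      fix t
      assume t: "\<bar>t\<bar> \<le> L"
      \<comment> \<open>The positions \<open>a + t\<close> lie in \<open>[k, k + 4 * L]\<close> and
        the positions \<open>b + t\<close> in \<open>[1 + L, m + 3 * L]\<close>. Both ranges are
        inside \<open>[1, m + N]\<close>; this is what \<open>4 * L + 1 \<le> N\<close> is
        for.\<close>
      show "x (b + t) = x (a + t)"
        using a b k t N L dvd by (intro word_eq) (auto simp: abs_le_iff)
    qed
    then have "\<pi> b - 2 * L - (\<pi> a - 2 * L) = b - a"
      by simp
    then have "cyclic_residue m (\<pi> b - 2 * L) = cyclic_residue m (\<pi> a - 2 * L)"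
      using dvd by (simp only: cyclic_residue_eq_iff)
    moreover have "int (cyclic_action m L \<rho> k) = b - 2 * L"
      using True b L by (simp add: cyclic_action_def b_def a_def)
    ultimately show ?thesis
      using True cyclic_action_range[OF True, of \<rho>] by (simp add: cyclic_action_def[of m L \<pi>]
          cyclic_action_def[of m L "\<lambda>a. \<pi> (\<rho> a)"] a_def)
  qed
qed

lemma cyclic_action_permutes:
  assumes "local_displacement x L \<pi>" "local_displacement x L \<rho>"
    "(\<lambda>a. \<pi> (\<rho> a)) = (\<lambda>a. a)" "(\<lambda>a. \<rho> (\<pi> a)) = (\<lambda>a. a)"
  shows "cyclic_action m L \<pi> permutes {1..nat m}"
proof (rule bij_imp_permutes)
  have 1: "cyclic_action m L \<pi> \<circ> cyclic_action m L \<rho> = id"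
    using assms by (simp add: cyclic_action_compose[symmetric] cyclic_action_id)
  have 2: "cyclic_action m L \<rho> \<circ> cyclic_action m L \<pi> = id"
    using assms by (simp add: cyclic_action_compose[symmetric] cyclic_action_id)
  show "bij_betw (cyclic_action m L \<pi>) {1..nat m} {1..nat m}"
  proof (rule bij_betw_byWitness)
    show "\<forall>k\<in>{1..nat m}. cyclic_action m L \<rho> (cyclic_action m L \<pi> k) = k"
      "\<forall>k\<in>{1..nat m}. cyclic_action m L \<pi> (cyclic_action m L \<rho> k) = k"
      using 1 2 by (simp_all add: fun_eq_iff)
  qed (intro image_subsetI cyclic_action_range; assumption)+
  show "cyclic_action m L \<pi> k = k" if "k \<notin> {1..nat m}" for k
    using that by (simp add: cyclic_action_def del: atLeastAtMost_iff)
qed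

text \<open>Every window of \<open>x\<close> occurs at a start inside the cyclic word, so the
  behaviour of both maps at any \<open>a\<close> is already visible in their cyclic actions.\<close>

lemma cyclic_action_inject:
  assumes \<pi>: "local_displacement x L \<pi>" and \<rho>: "local_displacement x L \<rho>"
    and eq: "cyclic_action m L \<pi> = cyclic_action m L \<rho>"
    and occurs: "\<And>a. \<exists>k. 1 \<le> k \<and> k \<le> m \<and> (\<forall>i. 0 \<le> i \<longrightarrow> i < N \<longrightarrow> x (k + i) = x (a + i))"
  shows "\<pi> = \<rho>"
proof
  fix a
  \<comment> \<open>The factor starts at \<open>a - 2 * L\<close> so that its copy at
    \<open>k\<close> has the counterpart of \<open>a\<close> at \<open>k + 2 * L\<close>, the centre
    used by \<open>cyclic_action\<close>.\<close>
  obtain k where k: "1 \<le> k" "k \<le> m" "\<And>i. 0 \<le> i \<Longrightarrow> i < N \<Longrightarrow> x (k + i) = x (a - 2 * L + i)"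
    using occurs by blast
  have window: "x (k + 2 * L + t) = x (a + t)" if "\<bar>t\<bar> \<le> L" for t
    using k(3)[of "2 * L + t"] that N by (simp add: algebra_simps)
  let ?c = "k + 2 * L"
  have action: "int (cyclic_action m L \<tau> (nat k)) = cyclic_residue m (\<tau> ?c - 2 * L)" for \<tau>
    using k(1,2) cyclic_residue_range[OF m_pos, of "\<tau> ?c - 2 * L"]
    by (simp add: cyclic_action_def nat_mono Suc_le_eq)
  have "cyclic_residue m (\<pi> ?c - 2 * L) = cyclic_residue m (\<rho> ?c - 2 * L)"
    using action[of \<pi>] action[of \<rho>] eq by simp
  then have "m dvd \<pi> ?c - \<rho> ?c"
    by (simp add: cyclic_residue_eq_iff)
  \<comment> \<open>The images differ by at most \<open>2 * L\<close>, which is less than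
    \<open>m\<close>, so congruence modulo \<open>m\<close> forces equality.\<close>
  moreover have "\<bar>\<pi> ?c - \<rho> ?c\<bar> < m"
    using local_displacement_bound[OF \<pi>, of ?c] local_displacement_bound[OF \<rho>, of ?c] L N m
    by linarith
  ultimately have "\<pi> ?c = \<rho> ?c"
    using dvd_imp_le_int[of "\<pi> ?c - \<rho> ?c" m] m_pos by fastforce
  then show "\<pi> a = \<rho> a"
    using local_displacement_cong[OF \<pi> window] local_displacement_cong[OF \<rho> window] by simp
qed

end

lemma periodic_window_exists:
  fixes x :: "int \<Rightarrow> 'a"
  assumes rec: "uniformly_recurrent x" and N: "4 * L + 1 \<le> N"
  defines "R \<equiv> int (recurrence_function x N)"
  obtains m where "m \<le> 2 * R" "periodic_window x m (int N) (int L)"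
    "\<And>a. \<exists>k. 1 \<le> k \<and> k \<le> m \<and> (\<forall>i. 0 \<le> i \<longrightarrow> i < int N \<longrightarrow> x (k + i) = x (a + i))"
proof -
  have N1: "N \<ge> 1"
    using N by simp
  \<comment> \<open>Searching from \<open>R + 1\<close> puts the repetition at \<open>m + 1\<close>
    with \<open>m = R + k\<close>. Hence \<open>m \<ge> R\<close>, while
    \<open>k + N \<le> R\<close> gives both \<open>N \<le> m\<close> and
    \<open>m \<le> 2 * R\<close>.\<close>
  obtain k where k: "0 \<le> k" "k + int N \<le> R"
    "\<And>i. 0 \<le> i \<Longrightarrow> i < int N \<Longrightarrow> x (R + 1 + k + i) = x (1 + i)"
    using recurrence_functionD[OF rec N1, of "R + 1" 1] unfolding R_def by blast
  define m where "m = R + k"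
  have "x (m + i) = x i" if "1 \<le> i" "i \<le> int N" for i
    using k(3)[of "i - 1"] that by (simp add: m_def algebra_simps)
  then have "periodic_window x m (int N) (int L)"
    using k N by unfold_locales (auto simp: m_def)
  moreover have "\<exists>k. 1 \<le> k \<and> k \<le> m \<and> (\<forall>i. 0 \<le> i \<longrightarrow> i < int N \<longrightarrow> x (k + i) = x (a + i))" for a
  proof -
    \<comment> \<open>The first \<open>R\<close> letters already contain every
      \<open>N\<close>-factor, and its start \<open>1 + j\<close> is at most \<open>R\<close>, hence
      at most \<open>m\<close>.\<close>
    obtain j where "0 \<le> j" "j + int N \<le> R"
      "\<And>i. 0 \<le> i \<Longrightarrow> i < int N \<Longrightarrow> x (1 + j + i) = x (a + i)"
      using recurrence_functionD[OF rec N1, of 1 a] unfolding R_def by blast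
    then show ?thesis
      using k(1) N1 by (intro exI[of _ "1 + j"]) (auto simp: m_def)
  qed
  ultimately show ?thesis
    using that[of m] k by (simp add: m_def)
qed


section \<open>Growth\<close>

text \<open>The infimum ranges over groups on \<open>nat\<close>, so \<open>Q\<close> is transported
  along an injection of its finite carrier into \<open>nat\<close>.\<close>

lemma LEF_growth_le_order:
  assumes Q: "group Q" "finite (carrier Q)" and \<phi>: "local_embedding G (word_ball G S n) Q \<phi>"
  shows "LEF_growth G S n \<le> enat (order Q)"
proof -
  obtain e :: "_ \<Rightarrow> nat" where e: "inj_on e (carrier Q)"
    using finite_imp_inj_to_nat_seg[OF Q(2)] by blast
  let ?Q = "image_group e Q"
  have mult: "e (a \<otimes>\<^bsub>Q\<^esub> b) = e a \<otimes>\<^bsub>?Q\<^esub> e b" if "a \<in> carrier Q" "b \<in> carrier Q" for a b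
    using that e by (simp add: image_group_def)
  have "local_embedding G (word_ball G S n) ?Q (e \<circ> \<phi>)"
    using \<phi> e mult unfolding local_embedding_def
    by (auto simp: image_group_carrier image_subset_iff intro!: comp_inj_on intro: inj_on_subset)
  moreover have "group ?Q"
    using Q(1) e by (rule group.inj_imp_image_group_is_group)
  moreover have "order ?Q = order Q" "finite (carrier ?Q)"
    using e Q(2) by (auto simp: order_def image_group_carrier card_image)
  ultimately show ?thesis
    unfolding LEF_growth_def by (intro Inf_lower) (metis (mono_tags, lifting) mem_Collect_eq)
qed

context nonperiodic_subshift
begin

text \<open>The cyclic action is injective and multiplicative on all elements of radius
  \<open>L\<close>, hence on the ball. It takes values in the symmetric group on \<open>m\<close>
  points, of order \<open>m!\<close>.\<close>

lemma LEF_growth_le_fact_recurrence: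
  assumes rec: "uniformly_recurrent x"
    and ball: "word_ball (TFG\<lparr>carrier := \<Gamma>\<rparr>) S n \<subseteq> local_elements (int L)"
    and N: "4 * L + 1 \<le> N"
  shows "LEF_growth (TFG\<lparr>carrier := \<Gamma>\<rparr>) S n \<le> enat (fact (2 * recurrence_function x N))"
proof -
  obtain m where m_le: "m \<le> 2 * int (recurrence_function x N)"
    and window: "periodic_window x m (int N) (int L)"
    and occurs: "\<And>a. \<exists>k. 1 \<le> k \<and> k \<le> m \<and> (\<forall>i. 0 \<le> i \<longrightarrow> i < int N \<longrightarrow> x (k + i) = x (a + i))"
    using periodic_window_exists[OF rec N] by metis
  interpret periodic_window x m "int N" "int L"
    by (rule window)
  let ?Q = "sym_group (nat m)"
  let ?\<phi> = "\<lambda>g. cyclic_action m (int L) (orbit_map x g)"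
  have in_Q: "?\<phi> g \<in> carrier ?Q" if "g \<in> local_elements (int L)" for g
  proof -
    have "?\<phi> g permutes {1..nat m}"
      using that
      by (intro cyclic_action_permutes[where \<rho> = "orbit_map x (inv\<^bsub>TFG\<^esub> g)"])
        (auto simp: local_elements_def orbit_map_mult[symmetric] orbit_map_one)
    then show ?thesis
      by (simp add: sym_group_carrier)
  qed
  have inj: "inj_on ?\<phi> (local_elements (int L))"
  proof (rule inj_onI)
    fix g h
    assume gh: "g \<in> local_elements (int L)" "h \<in> local_elements (int L)" "?\<phi> g = ?\<phi> h"
    then have "orbit_map x g = orbit_map x h"
      by (intro cyclic_action_inject[OF _ _ _ occurs]) (auto simp: local_elements_def)
    then show "g = h"
      using gh by (auto simp: local_elements_def intro: orbit_map_inject)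
  qed
  have mult: "?\<phi> (g \<otimes>\<^bsub>TFG\<^esub> h) = ?\<phi> g \<otimes>\<^bsub>?Q\<^esub> ?\<phi> h"
    if "g \<in> local_elements (int L)" "h \<in> local_elements (int L)" for g h
    using that by (simp add: local_elements_def orbit_map_mult cyclic_action_compose sym_group_mult)
  have "local_embedding (TFG\<lparr>carrier := \<Gamma>\<rparr>) (word_ball (TFG\<lparr>carrier := \<Gamma>\<rparr>) S n) ?Q ?\<phi>"
    unfolding local_embedding_def
    using in_Q inj_on_subset[OF inj ball] mult[OF subsetD[OF ball] subsetD[OF ball]]
      subsetD[OF ball]
    by (simp add: image_subset_iff)
  then have "LEF_growth (TFG\<lparr>carrier := \<Gamma>\<rparr>) S n \<le> enat (order ?Q)"
    by (intro LEF_growth_le_order sym_group_is_group)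
      (simp_all add: sym_group_def finite_permutations)
  also have "order ?Q = fact (nat m)"
    by (simp add: order_def sym_group_def card_permutations)
  also have "enat (fact (nat m)) \<le> enat (fact (2 * recurrence_function x N))"
    using m_le by (simp add: fact_mono_nat)
  finally show ?thesis .
qed

lemma LEF_growth_finitely_generated:
  assumes rec: "uniformly_recurrent x"
    and \<Gamma>: "subgroup \<Gamma> TFG" and S: "finite_generating_set TFG \<Gamma> S"
  shows "LEF_growth (TFG\<lparr>carrier := \<Gamma>\<rparr>) S \<preceq>\<^sub>g (\<lambda>n. enat (fact (2 * recurrence_function x n)))"
proof -
  have "finite S" "S \<subseteq> \<Gamma>"
    using S by (auto simp: finite_generating_set_def)
  then obtain r :: nat where r: "\<And>n. word_ball (TFG\<lparr>carrier := \<Gamma>\<rparr>) S n \<subseteq> local_elements (int (r * n))"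
    using word_ball_subset_local_elements[OF \<Gamma>] by metis
  \<comment> \<open>With \<open>L = r * n\<close> the window length
    \<open>N = (4 * r + 1) * n\<close> equals \<open>4 * L + n\<close>, which is at least
    \<open>4 * L + 1\<close> as \<open>n \<ge> 1\<close>. This is the source of the constant
    \<open>4 * r + 1\<close>.\<close>
  have "LEF_growth (TFG\<lparr>carrier := \<Gamma>\<rparr>) S n \<le> enat (fact (2 * recurrence_function x ((4 * r + 1) * n)))"
    if "n \<ge> 1" for n
    using that by (intro LEF_growth_le_fact_recurrence[OF rec r]) (simp add: algebra_simps)
  then show ?thesis
    unfolding growth_le_def by (intro exI[of _ "4 * r + 1"]) auto
qed

end

theorem theorem1p1:
  fixes x :: "int \<Rightarrow> 'a :: {finite, discrete_topology}"
    and X :: "(int \<Rightarrow> 'a) set"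
  assumes "CARD('a) \<ge> 2"
    and "uniformly_recurrent x"
    and "non_periodic x"
    and "X = orbit_closure x"
  shows "(\<forall>\<Gamma> S. subgroup \<Gamma> (topological_full_group X) \<and>
              finite_generating_set (topological_full_group X) \<Gamma> S \<longrightarrow>
            LEF_growth (topological_full_group X \<lparr>carrier := \<Gamma>\<rparr>) S
              \<preceq>\<^sub>g (\<lambda>n. enat (fact (2 * recurrence_function x n)))) \<and>
         (\<forall>S. finite_generating_set (topological_full_group X)
                (derived (topological_full_group X) (carrier (topological_full_group X))) S \<longrightarrow>
            LEF_growth (topological_full_group X \<lparr>carrier :=
                derived (topological_full_group X) (carrier (topological_full_group X))\<rparr>) S
              \<preceq>\<^sub>g (\<lambda>n. enat (fact (2 * recurrence_function x n))))"
proof -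
  interpret nonperiodic_subshift x
    by (rule nonperiodic_subshift.intro) (rule assms(3))
  show ?thesis
    unfolding assms(4)
    \<comment> \<open>The derived subgroup is a subgroup, so the second claim is an instance of the
      first.\<close>
    using LEF_growth_finitely_generated[OF assms(2)] TFG.derived_is_subgroup[OF subset_refl]
    by blast
qed

end
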